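(* Let $\alpha \approx 0.78265213271$ be the second largest real root of the polynomial $$54675\,a^{4}-2442195\,a^{3}+2182800\,a^{2}-115424\,a-96429 .$$ (1) Let $\{a_k\}_{k=1}^\infty$ be a sequence of positive real numbers satisfying $$a_{2j-1}\ \ge\ \frac{2j}{2j-1}\,a_{2j}\quad (j=1,2,3,\dots),\qquad a_2\ \ge\ \frac{3\alpha}{4}\,a_3,\qquad a_{2j}\ \ge\ \frac{2j+1}{2j+2}\,a_{2j+1}\quad (j=2,3,\dots).$$ Then $\sum a_k\sin(kx)$ is a PS in $[0,\pi]$, i.e. $\sum_{k=1}^n a_k\sin(kx)\ge 0$ for all $x\in[0,\pi]$ and all integers $n\ge 1$. (2) The maximal sum is the one with coefficient sequence $\{2\alpha,\alpha,\gamma_3,\gamma_4,\gamma_5,\dots\}$; that is, this sequence satisfies the conditions in (1), and $\{2\alpha,\alpha,\gamma_3,\gamma_4,\gamma_5,\dots\}\succeq\{a_k\}$ for every sequence $\{a_k\}$ of positive real numbers satisfying the conditions in (1). (3) The value $\alpha$ is best possible: for every real $a$ with $0<a<\alpha$, the sine polynomial $$2a\sin(x)+a\sin(2x)+\gamma_3\sin(3x)+\gamma_4\sin(4x)+\gamma_5\sin(5x)$$ is not nonnegative on $[0,\pi]$ (it takes a negative value at some point of $[0,\pi]$).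
   Context: For $k\ge 1$, $\gamma_k=\frac{k+1}{k}$ if $k$ is odd and $\gamma_k=1$ if $k$ is even; so $\gamma_3=\frac43$, $\gamma_4=1$, $\gamma_5=\frac65$. A sum is called a PS (P-Sum) on an interval if all its partial sums are nonnegative on that interval. For sequences of positive real numbers, $\{a_k\}\succeq\{b_k\}$ means that the sequence $b_k/a_k$ is non-increasing in $k$; sequences differing by a non-zero multiple are regarded as equivalent. A sequence is called maximal for a set of conditions if it satisfies the conditions and is $\succeq$ every sequence satisfying them. *)

theory Defs
  imports Complex_Main "HOL-Computational_Algebra.Polynomial"
begin

text \<open>
  Sequences \<open>a\<^sub>1, a\<^sub>2, \<dots>\<close> are functions on \<open>nat\<close> whose value at \<open>0\<close> is never
  looked at.
\<close>

definition gamma_seq :: "nat \<Rightarrow> real" where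
  "gamma_seq k = (if odd k then (real k + 1) / real k else 1)"

definition PS_on :: "real set \<Rightarrow> (nat \<Rightarrow> real \<Rightarrow> real) \<Rightarrow> bool" where
  "PS_on I f \<longleftrightarrow> (\<forall>n\<ge>1. \<forall>x\<in>I. 0 \<le> (\<Sum>k=1..n. f k x))"

definition positive_seq :: "(nat \<Rightarrow> real) \<Rightarrow> bool" where
  "positive_seq a \<longleftrightarrow> (\<forall>k\<ge>1. 0 < a k)"

text \<open>The relation \<open>{a\<^sub>k} \<succeq> {b\<^sub>k}\<close>, meant for positive sequences.\<close>

definition seq_dominates :: "(nat \<Rightarrow> real) \<Rightarrow> (nat \<Rightarrow> real) \<Rightarrow> bool" where
  "seq_dominates a b \<longleftrightarrow> antimono_on {1..} (\<lambda>k. b k / a k)"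

text \<open>
  Scaling a sequence by a positive constant does not affect \<open>seq_dominates\<close>, so the convention
  that proportional sequences are equivalent needs no quotient here.
\<close>

definition maximal_seq :: "((nat \<Rightarrow> real) \<Rightarrow> bool) \<Rightarrow> (nat \<Rightarrow> real) \<Rightarrow> bool" where
  "maximal_seq C a \<longleftrightarrow>
     positive_seq a \<and> C a \<and> (\<forall>b. positive_seq b \<and> C b \<longrightarrow> seq_dominates a b)"

definition alpha_poly :: "real poly" where
  "alpha_poly = [:-96429, -115424, 2182800, -2442195, 54675:]"

definition alpha :: real where
  "alpha = Max ({x. poly alpha_poly x = 0} - {Max {x. poly alpha_poly x = 0}})"

definition coeff_conditions :: "(nat \<Rightarrow> real) \<Rightarrow> bool" where
  "coeff_conditions a \<longleftrightarrow>
     (\<forall>j\<ge>1. a (2*j - 1) \<ge> (2 * real j) / (2 * real j - 1) * a (2*j)) \<and>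
     a 2 \<ge> 3 * alpha / 4 * a 3 \<and>
     (\<forall>j\<ge>2. a (2*j) \<ge> (2 * real j + 1) / (2 * real j + 2) * a (2*j + 1))"

definition max_seq :: "nat \<Rightarrow> real" where
  "max_seq k = (if k = 1 then 2 * alpha else if k = 2 then alpha else gamma_seq k)"

text \<open>
  The polynomial has four simple real roots, so counting roots with or without multiplicity makes
  no difference, and the second largest one is \<open>0.78265213295\<dots>\<close>.
\<close>

lemma alpha_root: "poly alpha_poly alpha = 0"
  and alpha_bounds: "0.78265213295 < alpha" "alpha < 0.78265213296"
proof -
  let ?p = alpha_poly
  let ?R = "{x. poly ?p x = 0}"
  have ev: "poly ?p x = 54675*x^4 - 2442195*x^3 + 2182800*x^2 - 115424*x - 96429" for x
    by (simp add: alpha_poly_def algebra_simps power_numeral_reduce)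
  have "\<exists>x>-1. x < 0 \<and> poly ?p x = 0"
    by (rule poly_IVT_neg) (simp_all add: ev)
  then obtain r1 where r1: "-1 < r1" "r1 < 0" "poly ?p r1 = 0" by blast
  have "\<exists>x>0. x < 0.7 \<and> poly ?p x = 0"
    by (rule poly_IVT_pos) (simp_all add: ev power_divide)
  then obtain r2 where r2: "0 < r2" "r2 < 0.7" "poly ?p r2 = 0" by blast
  have "\<exists>x>0.78265213295. x < 0.78265213296 \<and> poly ?p x = 0"
    by (rule poly_IVT_neg) (simp_all add: ev power_divide)
  then obtain r3 where r3: "0.78265213295 < r3" "r3 < 0.78265213296" "poly ?p r3 = 0" by blast
  have "\<exists>x>1. x < 100 \<and> poly ?p x = 0"
    by (rule poly_IVT_pos) (simp_all add: ev)
  then obtain r4 where r4: "1 < r4" "r4 < 100" "poly ?p r4 = 0" by blast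
  have nz: "?p \<noteq> 0" and deg: "degree ?p = 4" by (simp_all add: alpha_poly_def)
  have fin: "finite ?R" using poly_roots_finite[OF nz] .
  have sub: "{r1, r2, r3, r4} \<subseteq> ?R" using r1 r2 r3 r4 by auto
  have "card {r1, r2, r3, r4} = 4" using r1 r2 r3 r4 by auto
  then have R: "?R = {r1, r2, r3, r4}"
    using card_seteq[OF fin sub] card_poly_roots_bound[OF nz] deg by simp
  have "Max ?R = r4" unfolding R using r1 r2 r3 r4 by simp
  moreover have "?R - {r4} = {r1, r2, r3}" unfolding R using r1 r2 r3 r4 by auto
  ultimately have "alpha = r3" unfolding alpha_def using r1 r2 r3 r4 by simp
  then show "poly ?p alpha = 0" "0.78265213295 < alpha" "alpha < 0.78265213296"
    using r3 by auto
qed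

end

theory Submission
  imports Defs "HOL-Analysis.Complex_Transcendental"
begin

text \<open>
  The conditions bound each term by a fixed multiple of the preceding one, and the sequence
  \<open>max_seq\<close> satisfies all of them with equality.  Hence the quotient of an admissible sequence by
  \<open>max_seq\<close> is nonincreasing (\<open>max_seq_dominates\<close>), and by Abel summation (\<open>weighted_sum_ge\<close>) the sine
  sums of every admissible sequence are nonnegative as soon as those of \<open>max_seq\<close> are.  What has to
  be shown is therefore a statement about the sums of one sequence.

  The constant \<open>alpha\<close> is dictated by the fifth of these sums.  Divided by \<open>sin x\<close> it is a quartic
  polynomial in \<open>cos x\<close> whose coefficients depend linearly on the parameter \<open>a\<close>.  The polynomial that
  defines \<open>alpha\<close> arises by eliminating \<open>cos x\<close> from the condition that this quartic has a double root, and at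
  \<open>a = alpha\<close> the quartic is the square of a linear factor times a positive quadratic one
  (\<open>alpha_tangency\<close>, \<open>quintic_factor_alpha_nonneg\<close>).  At the double root the value is negative for every
  smaller parameter.

  All other sums with three or more terms leave some room, apart from zeros at the end points.
  Those with at most twelve terms are polynomials in \<open>cos x\<close> after division by \<open>sin x\<close>, and they are shown to be nonnegative by
  inspecting Bernstein coefficients after a few bisections (\<open>nonneg_test_sound\<close>, \<open>short_sums_test\<close>).

  For the sums with \<open>n = 2*m - 1\<close> or \<open>n = 2*m\<close> terms and \<open>m \<ge> 7\<close> put \<open>y = pi - x\<close> and
  \<open>t = tan (y/2)\<close>.  Writing the odd coefficients \<open>(k + 1)/k\<close> as \<open>1 + 1/k\<close> splits the sum into a
  geometric part with a closed form and a partial sum of the Fourier series of a square wave: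
  twice the sum with coefficients \<open>gamma_seq\<close> is
  \<open>t * (1 - cos (2*m*y)) \<plusminus> sin (2*m*y) + 2 * odd_sine_sum m y\<close>.  The last summand is at least
  \<open>pi/2 - (1 + cos (2*m*y)) * e\<close> with \<open>e = 1/(2*m*sin y)\<close> (\<open>odd_sine_sum_ge\<close>).  So, by
  Cauchy-Schwarz, the whole expression is at least \<open>pi/2 + t - e - sqrt (1 + (t + e)\<^sup>2)\<close>, whatever the
  phase \<open>2*m*y\<close> and the parity of \<open>n\<close>.  This exceeds the contribution
  \<open>4 * (1 - alpha) * sin y * (1 - cos y)\<close> of the two modified coefficients, except within distance
  \<open>pi/(2*m)\<close> of the end points, where the terms are nonnegative one by one or in pairs
  (\<open>max_sum_nonneg_left\<close>, \<open>max_sum_nonneg_right\<close>).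
\<close>

section \<open>The comparison principle and the maximal sequence\<close>

text \<open>
  Abel summation in a form that is preserved from \<open>n\<close> to \<open>n + 1\<close>: mere nonnegativity of the
  weighted sum would be too weak a hypothesis for the induction step.
\<close>
lemma weighted_sum_ge:
  fixes c u :: "nat \<Rightarrow> real"
  assumes part: "\<And>n. 1 \<le> n \<Longrightarrow> 0 \<le> (\<Sum>k=1..n. u k)"
    and c0: "\<And>k. 1 \<le> k \<Longrightarrow> 0 \<le> c k"
    and dec: "\<And>k. 1 \<le> k \<Longrightarrow> c (Suc k) \<le> c k"
    and n: "1 \<le> n"
  shows "c n * (\<Sum>k=1..n. u k) \<le> (\<Sum>k=1..n. c k * u k)"
  using n
proof (induction n rule: dec_induct)
  case base
  show ?case by simp
next
  case (step n)
  have "c (Suc n) * (\<Sum>k=1..n. u k) \<le> c n * (\<Sum>k=1..n. u k)"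
    using part[OF step(1)] dec[OF step(1)] by (intro mult_right_mono)
  with step.IH show ?case by (simp add: distrib_left)
qed

lemma PS_on_if_dominated:
  assumes a: "positive_seq a" and b: "positive_seq b" and dom: "seq_dominates a b"
    and PS: "PS_on I (\<lambda>k x. a k * s k x)"
  shows "PS_on I (\<lambda>k x. b k * s k x)"
  unfolding PS_on_def
proof (intro allI impI ballI)
  fix n :: nat and x assume n: "1 \<le> n" and x: "x \<in> I"
  have part: "0 \<le> (\<Sum>k=1..n. a k * s k x)" if "1 \<le> n" for n
    using PS x that unfolding PS_on_def by blast
  have c0: "0 \<le> b k / a k" if "1 \<le> k" for k
    using a b that unfolding positive_seq_def by (simp add: less_imp_le)
  have dec: "b (Suc k) / a (Suc k) \<le> b k / a k" if "1 \<le> k" for k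
    using dom that unfolding seq_dominates_def monotone_on_def by simp
  have "0 \<le> b n / a n * (\<Sum>k=1..n. a k * s k x)"
    using part[OF n] c0[OF n] by (rule mult_nonneg_nonneg[rotated])
  also have "\<dots> \<le> (\<Sum>k=1..n. b k / a k * (a k * s k x))"
    using part c0 dec n by (rule weighted_sum_ge)
  also have "\<dots> = (\<Sum>k=1..n. b k * s k x)"
    using a unfolding positive_seq_def by (intro sum.cong) (auto simp: field_simps dest: spec)
  finally show "0 \<le> (\<Sum>k=1..n. b k * s k x)" .
qed

lemma max_seq_simps:
  "max_seq (Suc 0) = 2 * alpha" "max_seq 2 = alpha" "max_seq 3 = 4/3"
  "2 \<le> j \<Longrightarrow> max_seq (2*j - Suc 0) = 2 * real j / (2 * real j - 1)"
  "2 \<le> j \<Longrightarrow> max_seq (2*j) = 1"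
  "2 \<le> j \<Longrightarrow> max_seq (Suc (2*j)) = (2 * real j + 2) / (2 * real j + 1)"
  by (auto simp: max_seq_def gamma_seq_def of_nat_diff add_ac)

lemma positive_max_seq: "positive_seq max_seq"
  using alpha_bounds unfolding positive_seq_def max_seq_def gamma_seq_def by auto

lemma coeff_conditions_max_seq: "coeff_conditions max_seq"
  unfolding coeff_conditions_def
proof (intro conjI allI impI)
  fix j :: nat assume "1 \<le> j"
  show "2 * real j / (2 * real j - 1) * max_seq (2 * j) \<le> max_seq (2 * j - 1)"
  proof (cases "j = 1")
    case True
    then show ?thesis by (simp add: max_seq_simps)
  next
    case False
    with \<open>1 \<le> j\<close> show ?thesis by (simp add: max_seq_simps)
  qed
next
  show "3 * alpha / 4 * max_seq 3 \<le> max_seq 2"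
    by (simp add: max_seq_simps)
next
  fix j :: nat assume "2 \<le> j"
  then show "(2 * real j + 1) / (2 * real j + 2) * max_seq (2 * j + 1) \<le> max_seq (2 * j)"
    by (simp add: max_seq_simps)
qed

text \<open>
  Each condition compares two consecutive terms, and it is an equality for \<open>max_seq\<close>.  So it says
  exactly that the quotient by \<open>max_seq\<close> does not increase at that place.
\<close>
lemma max_seq_dominates:
  assumes b: "positive_seq b" "coeff_conditions b"
  shows "seq_dominates max_seq b"
proof -
  have step: "b (Suc k) / max_seq (Suc k) \<le> b k / max_seq k" if "1 \<le> k" for k
  proof (cases "even k")
    case True
    then obtain j where k: "k = 2 * j" by blast
    then have j: "1 \<le> j" using that by simp
    show ?thesis
    proof (cases "j = 1")
      case True
      have "3 * alpha / 4 * b 3 \<le> b 2" using b unfolding coeff_conditions_def by blast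
      then have "b 3 / (4/3) \<le> b 2 / alpha"
        using alpha_bounds by (simp add: field_simps)
      then show ?thesis using True k by (simp add: max_seq_simps(2) max_seq_simps(3)[unfolded numeral_3_eq_3] numeral_3_eq_3)
    next
      case False
      then have j: "2 \<le> j" using j by simp
      then have "(2 * real j + 1) / (2 * real j + 2) * b (2 * j + 1) \<le> b (2 * j)"
        using b unfolding coeff_conditions_def by blast
      then show ?thesis
        using j by (simp add: k max_seq_simps) (simp add: field_simps)
    qed
  next
    case False
    then obtain i where i: "k = 2 * i + 1" by (elim oddE)
    define j where "j = Suc i"
    have k: "k = 2 * j - 1" "Suc k = 2 * j" "1 \<le> j" by (simp_all add: i j_def)
    have "2 * real j / (2 * real j - 1) * b (2 * j) \<le> b (2 * j - 1)"
      using b k(3) unfolding coeff_conditions_def by blast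
    then have *: "b (2 * j) \<le> b (2 * j - 1) * (2 * real j - 1) / (2 * real j)"
      using k(3) by (simp add: field_simps)
    show ?thesis
    proof (cases "j = 1")
      case True
      then have "b 2 / max_seq 2 \<le> b (Suc 0) / max_seq (Suc 0)"
        using * alpha_bounds by (simp add: max_seq_simps field_simps flip: numeral_2_eq_2)
      then show ?thesis using True k by (simp add: numeral_2_eq_2)
    next
      case False
      then have "2 \<le> j" using k(3) by simp
      then show ?thesis
        unfolding k(2) using * by (simp add: k(1) max_seq_simps)
    qed
  qed
  have "b n / max_seq n \<le> b m / max_seq m" if "1 \<le> m" "m \<le> n" for m n
    using that(2) by (induction n rule: dec_induct) (use step that(1) in \<open>auto intro: order_trans\<close>)
  then show ?thesis unfolding seq_dominates_def monotone_on_def by simp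
qed

lemma maximal_max_seq: "maximal_seq coeff_conditions max_seq"
  unfolding maximal_seq_def
  using positive_max_seq coeff_conditions_max_seq max_seq_dominates by blast

section \<open>The extremal quintic\<close>

text \<open>
  Divided by \<open>sin x\<close>, the fifth sum is \<open>2/15\<close> times this polynomial in \<open>c = cos x\<close>.
\<close>
definition quintic_factor :: "real \<Rightarrow> real \<Rightarrow> real" where
  "quintic_factor a c = 144*c^4 + 60*c^3 - 68*c^2 + 15*(a - 2)*c + 15*a - 1"

lemma sin_multiples:
  fixes x :: real
  defines "c \<equiv> cos x"
  shows "sin (2*x) = sin x * (2*c)"
    and "sin (3*x) = sin x * (4*c^2 - 1)"
    and "sin (4*x) = sin x * (8*c^3 - 4*c)"
    and "sin (5*x) = sin x * (16*c^4 - 12*c^2 + 1)"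
proof -
  have rec: "sin ((r + 1)*x) = 2*c * sin (r*x) - sin ((r - 1)*x)" for r :: real
    by (simp add: c_def distrib_right left_diff_distrib sin_add sin_diff)
  have r: "sin (2*x) = 2*c * sin x" "sin (3*x) = 2*c * sin (2*x) - sin x"
    "sin (4*x) = 2*c * sin (3*x) - sin (2*x)" "sin (5*x) = 2*c * sin (4*x) - sin (3*x)"
    using rec[of 1] rec[of 2] rec[of 3] rec[of 4] by simp_all
  show 2: "sin (2*x) = sin x * (2*c)"
    unfolding r(1) by simp
  show 3: "sin (3*x) = sin x * (4*c^2 - 1)"
    unfolding r(2) 2 by (simp add: algebra_simps power2_eq_square)
  show 4: "sin (4*x) = sin x * (8*c^3 - 4*c)"
    unfolding r(3) 2 3 by (simp add: algebra_simps power_numeral_reduce)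
  show "sin (5*x) = sin x * (16*c^4 - 12*c^2 + 1)"
    unfolding r(4) 3 4 by (simp add: algebra_simps power_numeral_reduce)
qed

lemma quintic_sum_eq:
  "2 * a * sin x + a * sin (2 * x) + gamma_seq 3 * sin (3 * x) + gamma_seq 4 * sin (4 * x)
     + gamma_seq 5 * sin (5 * x) = 2/15 * (sin x * quintic_factor a (cos x))"
  unfolding sin_multiples quintic_factor_def gamma_seq_def
  by (simp add: algebra_simps power_numeral_reduce)

text \<open>
  The factor is increasing in \<open>a\<close> and vanishes at \<open>a = f c\<close> with
  \<open>f c = (1 + 30*c + 68*c\<^sup>2 - 60*c\<^sup>3 - 144*c\<^sup>4) / (15*(1 + c))\<close>.  So the best parameter is the maximum
  of \<open>f\<close> on \<open>(-1,1]\<close>, and the quartic \<open>q\<close> below is the numerator of \<open>f'\<close>.  Eliminating \<open>c\<close> from \<open>a = f c\<close> and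
  \<open>q c = 0\<close> leads to the polynomial that defines \<open>alpha\<close>.
\<close>
lemma alpha_tangency:
  obtains c where "0.42 < c" "c < 0.43" "29 + 136*c - 112*c^2 - 696*c^3 - 432*c^4 = 0"
    and "quintic_factor alpha c = 0"
proof -
  define q :: "real poly" where "q = [:29, 136, -112, -696, -432:]"
  have q: "poly q c = 29 + 136*c - 112*c^2 - 696*c^3 - 432*c^4" for c
    by (simp add: q_def algebra_simps power_numeral_reduce)
  have "\<exists>c>0.422. c < 0.424 \<and> poly q c = 0"
    by (rule poly_IVT_neg) (simp_all add: q power_divide)
  then obtain c :: real where c: "0.422 < c" "c < 0.424" and qc: "29 + 136*c - 112*c^2 - 696*c^3 - 432*c^4 = 0"
    unfolding q by blast
  define a where "a = (1 + 30*c + 68*c^2 - 60*c^3 - 144*c^4) / (15*(1 + c))"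
  have ac: "15*(1 + c)*a = 1 + 30*c + 68*c^2 - 60*c^3 - 144*c^4"
    using c by (simp add: a_def)
  have ev: "poly alpha_poly x = 54675*x^4 - 2442195*x^3 + 2182800*x^2 - 115424*x - 96429" for x
    by (simp add: alpha_poly_def algebra_simps power_numeral_reduce)
  have root: "poly alpha_poly a = 0"
  proof -
    have "(15*(1 + c))^4 * poly alpha_poly a
        = 54675*(15*(1 + c)*a)^4 - 2442195*(15*(1 + c)*a)^3*(15*(1 + c))
          + 2182800*(15*(1 + c)*a)^2*(15*(1 + c))^2 - 115424*(15*(1 + c)*a)*(15*(1 + c))^3
          - 96429*(15*(1 + c))^4"
      unfolding ev by (simp add: algebra_simps power_numeral_reduce)
    (* the cofactor of the squared quartic in the eliminant *)
    also have "\<dots> = (29 + 136*c - 112*c^2 - 696*c^3 - 432*c^4)^2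
        * (-5727375 + 47465325*c + 72748800*c^2 - 235731600*c^3 - 220970025*c^4
           + 377913600*c^5 + 132386400*c^6 - 195955200*c^7 + 125971200*c^8)"
      unfolding ac by (simp add: algebra_simps power_numeral_reduce)
    also have "\<dots> = 0" using qc by simp
    finally show ?thesis using c by simp
  qed
  have "a = alpha"
  proof -
    have pw: "0.178 \<le> c^2" "c^2 \<le> 0.18" "0.075 \<le> c^3" "c^3 \<le> 0.0765" "0.0317 \<le> c^4" "c^4 \<le> 0.0325"
      using power_mono[of "0.422" c 2] power_mono[of c "0.424" 2] power_mono[of "0.422" c 3]
        power_mono[of c "0.424" 3] power_mono[of "0.422" c 4] power_mono[of c "0.424" 4] c
      by (simp_all add: power_divide)
    have "0.77 * (15*(1 + c)) < a * (15*(1 + c))" "a * (15*(1 + c)) < 0.8 * (15*(1 + c))"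
      using ac pw c by (simp_all add: mult.commute)
    then have a: "0.77 < a" "a < 0.8" using c by (simp_all only: mult_less_cancel_right) auto
    (* alpha_poly decreases on [0.77, 0.8]: its difference quotient is negative there *)
    have mono: "54675*(a^3 + a^2*alpha + a*alpha^2 + alpha^3) - 2442195*(a^2 + a*alpha + alpha^2)
        + 2182800*(a + alpha) - 115424 < 0" (is "?s < 0")
    proof -
      have "0.77 * 0.77 \<le> x * y" "x * y \<le> 0.8 * 0.8" if "0.77 < x" "0.77 < y" "x < 0.8" "y < 0.8" for x y :: real
        using that mult_mono[of "0.77" x "0.77" y] mult_mono[of x "0.8" y "0.8"] by auto
      note two = this
      have "x^3 \<le> 0.52" "x^2 * y \<le> 0.52" "x * y^2 \<le> 0.52" if "0.77 < x" "0.77 < y" "x < 0.8" "y < 0.8" for x y :: real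
        using that mult_mono[of "x * x" "0.8*0.8" x "0.8"] mult_mono[of "x * x" "0.8*0.8" y "0.8"]
           mult_mono[of x "0.8" "y*y" "0.8*0.8"] two[of x x] two[of y y]
        by (auto simp: power2_eq_square power3_eq_cube)
      note three = this
      show ?thesis
        using two[of a a] two[of a alpha] two[of alpha alpha] three[of a alpha] three[of alpha a]
          a alpha_bounds unfolding power2_eq_square
        by (simp add: power2_eq_square)
    qed
    have "(a - alpha) * ?s = poly alpha_poly a - poly alpha_poly alpha"
      unfolding ev by (simp add: algebra_simps power_numeral_reduce)
    then have "(a - alpha) * ?s = 0" by (simp add: root alpha_root)
    with mono show ?thesis by simp
  qed
  then have "quintic_factor alpha c = 0"
    using ac by (simp add: quintic_factor_def algebra_simps)
  then show thesis using that[of c] c qc by simp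
qed

text \<open>
  At the point \<open>d\<close> of tangency both the value and the derivative vanish, so Taylor expansion
  leaves \<open>(c - d)\<^sup>2\<close> times a quadratic polynomial, which has negative discriminant for \<open>d \<ge> 0.42\<close>.
\<close>
lemma quintic_factor_alpha_nonneg: "0 \<le> quintic_factor alpha c"
proof -
  obtain d where d: "0.42 < d" "d < 0.43" and q: "29 + 136*d - 112*d^2 - 696*d^3 - 432*d^4 = 0"
    and zero: "quintic_factor alpha d = 0"
    by (rule alpha_tangency)
  have deriv: "576*d^3 + 180*d^2 - 136*d + 15*(alpha - 2) = 0"
  proof -
    have "(1 + d) * (576*d^3 + 180*d^2 - 136*d + 15*(alpha - 2))
        = quintic_factor alpha d - (29 + 136*d - 112*d^2 - 696*d^3 - 432*d^4)"
      by (simp add: quintic_factor_def algebra_simps power_numeral_reduce)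
    then show ?thesis using zero q d by simp
  qed
  have "quintic_factor alpha c = quintic_factor alpha d
      + (c - d) * (576*d^3 + 180*d^2 - 136*d + 15*(alpha - 2))
      + (c - d)^2 * (144*c^2 + (60 + 288*d)*c + (432*d^2 + 120*d - 68))"
    by (simp add: quintic_factor_def algebra_simps power_numeral_reduce)
  moreover have "0 \<le> 144*c^2 + (60 + 288*d)*c + (432*d^2 + 120*d - 68)" (is "0 \<le> ?r")
  proof -
    (* completing the square in c *)
    have "0.42^2 \<le> d^2" using d by (intro power_mono) auto
    then have "0 \<le> (288*c + 60 + 288*d)^2 + (165888*d^2 + 34560*d - 42768)"
      using d by (intro add_nonneg_nonneg) (simp_all add: power_divide)
    also have "\<dots> = 576 * ?r"
      by (simp add: algebra_simps power_numeral_reduce)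
    finally show ?thesis by simp
  qed
  ultimately show ?thesis unfolding zero deriv by simp
qed

lemma quintic_sum_negative:
  assumes "a < alpha"
  shows "\<exists>x\<in>{0..pi}. 2 * a * sin x + a * sin (2 * x) + gamma_seq 3 * sin (3 * x)
           + gamma_seq 4 * sin (4 * x) + gamma_seq 5 * sin (5 * x) < 0"
proof -
  obtain c where c: "0.42 < c" "c < 0.43" and zero: "quintic_factor alpha c = 0"
    by (rule alpha_tangency)
  have "quintic_factor a c = quintic_factor alpha c - 15 * ((alpha - a) * (1 + c))"
    by (simp add: quintic_factor_def algebra_simps)
  then have neg: "quintic_factor a c < 0" using zero c assms by simp
  have "0 < arccos c" "arccos c < pi" using c arccos_lt_bounded[of c] by simp_all
  then have "0 < sin (arccos c)" by (rule sin_gt_zero)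
  moreover have "cos (arccos c) = c" using c by simp
  ultimately have "sin (arccos c) * quintic_factor a (cos (arccos c)) < 0"
    using neg by (simp add: mult_pos_neg)
  then have "2 * a * sin (arccos c) + a * sin (2 * arccos c) + gamma_seq 3 * sin (3 * arccos c)
      + gamma_seq 4 * sin (4 * arccos c) + gamma_seq 5 * sin (5 * arccos c) < 0"
    unfolding quintic_sum_eq by simp
  then show ?thesis using \<open>0 < arccos c\<close> \<open>arccos c < pi\<close> by (intro bexI[of _ "arccos c"]) auto
qed

section \<open>Nonnegativity of integer polynomials on the unit interval\<close>

text \<open>
  Polynomials are lists of integer coefficients, lowest degree first, so that the test below can be
  carried out by rewriting.
\<close>
abbreviation peval :: "int list \<Rightarrow> real \<Rightarrow> real" where
  "peval p x \<equiv> horner_sum of_int x p"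

fun padd :: "int list \<Rightarrow> int list \<Rightarrow> int list" where
  "padd [] q = q"
| "padd p [] = p"
| "padd (a # p) (b # q) = (a + b) # padd p q"

lemma peval_padd: "peval (padd p q) x = peval p x + peval q x"
  by (induction p q rule: padd.induct) (simp_all add: algebra_simps)

text \<open>The list of \<open>c + (a + b*x) * p x\<close>; it is the Horner step for substituting \<open>a + b*x\<close>.\<close>
fun linear_step :: "int \<Rightarrow> int \<Rightarrow> int \<Rightarrow> int list \<Rightarrow> int list" where
  "linear_step a b c [] = [c]"
| "linear_step a b c (q # p) = (c + a * q) # linear_step a b (b * q) p"

lemma peval_linear_step:
  "peval (linear_step a b c p) x = of_int c + (of_int a + of_int b * x) * peval p x"
  by (induction p arbitrary: c) (simp_all add: algebra_simps)

fun psubst :: "int \<Rightarrow> int \<Rightarrow> int list \<Rightarrow> int list" where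
  "psubst a b [] = []"
| "psubst a b (c # p) = linear_step a b c (psubst a b p)"

lemma peval_psubst: "peval (psubst a b p) x = peval p (of_int a + of_int b * x)"
  by (induction p) (simp_all add: peval_linear_step)

text \<open>The substitution \<open>x \<mapsto> x/2\<close>, with denominators cleared.\<close>
fun phalve :: "int list \<Rightarrow> int list" where
  "phalve [] = []"
| "phalve (c # p) = (2 ^ length p * c) # phalve p"

lemma peval_phalve: "2 * peval (phalve p) x = 2 ^ length p * peval p (x/2)"
  by (induction p) (simp_all add: algebra_simps)

lemma peval_rev:
  assumes "x \<noteq> 0"
  shows "x * peval p x = x ^ length p * peval (rev p) (1/x)"
  using assms
  by (induction p) (simp_all add: horner_sum_append algebra_simps power_divide)

lemma peval_nonneg:
  assumes "\<forall>c\<in>set p. 0 \<le> c" and "0 \<le> x"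
  shows "0 \<le> peval p x"
  using assms by (induction p) simp_all

text \<open>
  The map \<open>s \<mapsto> 1/(1 + s)\<close> sends \<open>(0,\<infinity>)\<close> onto \<open>(0,1)\<close>.  If all coefficients are nonnegative after this
  substitution (up to normalization these are the Bernstein coefficients), then the polynomial is
  nonnegative on \<open>(0,1)\<close>.  Otherwise the test is repeated on the two halves of the interval, and the
  first argument bounds the number of bisections.
\<close>
fun nonneg_test :: "nat \<Rightarrow> int list \<Rightarrow> bool" where
  "nonneg_test 0 p = list_all (\<lambda>c. 0 \<le> c) (psubst 1 1 (rev p))"
| "nonneg_test (Suc k) p =
     (if list_all (\<lambda>c. 0 \<le> c) (psubst 1 1 (rev p)) then True
      else let h = phalve p in nonneg_test k h \<and> nonneg_test k (psubst 1 1 h))"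

lemma bernstein_nonneg:
  assumes "list_all (\<lambda>c. 0 \<le> c) (psubst 1 1 (rev p))" and "0 < x" "x \<le> 1"
  shows "0 \<le> peval p x"
proof -
  have "0 \<le> peval (psubst 1 1 (rev p)) (1/x - 1)"
    using assms by (intro peval_nonneg) (auto simp: list_all_iff)
  then have "0 \<le> x * peval p x"
    using assms peval_rev[of x p] by (simp add: peval_psubst)
  then show ?thesis using assms by (simp add: zero_le_mult_iff)
qed

lemma nonneg_test_sound:
  assumes "nonneg_test k p" and "0 < x" "x \<le> 1"
  shows "0 \<le> peval p x"
  using assms
proof (induction k arbitrary: p x)
  case 0
  then show ?case by (simp add: bernstein_nonneg)
next
  case (Suc k)
  show ?case
  proof (cases "list_all (\<lambda>c. 0 \<le> c) (psubst 1 1 (rev p))")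
    case True
    then show ?thesis using Suc.prems by (intro bernstein_nonneg)
  next
    case False
    then have halves: "nonneg_test k (phalve p)" "nonneg_test k (psubst 1 1 (phalve p))"
      using Suc.prems(1) by (simp_all add: Let_def)
    have "0 \<le> peval (phalve p) (2*x)"
    proof (cases "2*x \<le> 1")
      case True
      then show ?thesis using halves(1) Suc by simp
    next
      case False
      then have "0 \<le> peval (psubst 1 1 (phalve p)) (2*x - 1)"
        using halves(2) Suc by simp
      then show ?thesis by (simp add: peval_psubst)
    qed
    then have "0 \<le> 2 ^ length p * peval p x" using peval_phalve[of "2*x" p] by simp
    then show ?thesis by (simp add: zero_le_mult_iff not_le[of "2 ^ length p", THEN iffD2])
  qed
qed

section \<open>Short sums\<close>

text \<open>
  Clenshaw's recurrence for \<open>\<Sum>k. a\<^sub>k sin (k*x) / sin x\<close>, written in the variable \<open>u = (1 + cos x)/2\<close>,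
  which runs through \<open>(0,1)\<close>; note \<open>2 * cos x = 4*u - 2\<close>.
\<close>
fun clenshaw :: "int list \<Rightarrow> int list \<times> int list" where
  "clenshaw [] = ([], [])"
| "clenshaw (a # as) =
     (let (b, b') = clenshaw as in (padd (linear_step (-2) 4 a b) (map uminus b'), b))"

lemma peval_uminus: "peval (map uminus p) x = - peval p x"
  by (induction p) simp_all

lemma clenshaw_sum:
  fixes x :: real
  defines "u \<equiv> (1 + cos x)/2"
  shows "(\<Sum>k<length as. of_int (as ! k) * sin (real (k + j) * x + x))
     = peval (fst (clenshaw as)) u * sin (real j * x + x) - peval (snd (clenshaw as)) u * sin (real j * x)"
proof (induction as arbitrary: j)
  case Nil
  show ?case by simp
next
  case (Cons a as)
  obtain b b' where b: "clenshaw as = (b, b')" by (cases "clenshaw as")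
  have tri: "sin (real j * x + x + x) = (4*u - 2) * sin (real j * x + x) - sin (real j * x)"
  proof -
    have "sin (real j * x) = sin ((real j * x + x) - x)" by simp
    then show ?thesis unfolding sin_add[of "real j * x + x" x] sin_diff
      by (simp add: u_def field_simps)
  qed
  have "(\<Sum>k<length (a # as). of_int ((a # as) ! k) * sin (real (k + j) * x + x))
      = of_int a * sin (real j * x + x) + (\<Sum>k<length as. of_int (as ! k) * sin (real (k + Suc j) * x + x))"
    by (simp add: sum.lessThan_Suc_shift algebra_simps del: sum.lessThan_Suc)
  also have "\<dots> = of_int a * sin (real j * x + x)
      + (peval b u * sin (real j * x + x + x) - peval b' u * sin (real j * x + x))"
    using Cons[of "Suc j"] by (simp add: b algebra_simps)
  also have "\<dots> = peval (fst (clenshaw (a # as))) u * sin (real j * x + x)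
      - peval (snd (clenshaw (a # as))) u * sin (real j * x)"
    unfolding tri by (simp add: b peval_padd peval_linear_step peval_uminus algebra_simps)
  finally show ?case .
qed

lemma sine_sum_nonneg_test:
  assumes "nonneg_test d (fst (clenshaw as))" and "0 < x" "x < pi"
  shows "0 \<le> (\<Sum>k=1..length as. of_int (as ! (k - 1)) * sin (real k * x))"
proof -
  have "(\<Sum>k=1..length as. of_int (as ! (k - 1)) * sin (real k * x))
      = (\<Sum>k<length as. of_int (as ! k) * sin (real (k + 0) * x + x))"
    by (rule sum.reindex_bij_witness[of _ "\<lambda>k. k + 1" "\<lambda>k. k - 1"]) (auto simp: algebra_simps of_nat_diff)
  also have "\<dots> = peval (fst (clenshaw as)) ((1 + cos x)/2) * sin x"
    unfolding clenshaw_sum by simp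
  also have "0 \<le> \<dots>"
  proof (rule mult_nonneg_nonneg)
    have "-1 < cos x" using cos_monotone_0_pi[of x pi] assms by simp
    then show "0 \<le> peval (fst (clenshaw as)) ((1 + cos x)/2)"
      by (intro nonneg_test_sound[OF assms(1)]) simp_all
    show "0 \<le> sin x" using assms by (intro sin_ge_zero) simp_all
  qed
  finally show ?thesis .
qed


text \<open>
  The coefficients \<open>max_seq\<close> multiplied by \<open>1732500 = 500 * 3465\<close>, with \<open>alpha\<close> replaced by the lower
  bound \<open>0.782\<close>.  This loss is affordable for all these sums but the fifth.  The factor clears all denominators up to the twelfth term, as
  \<open>3465\<close> is the least common multiple of \<open>1, 3, \<dots>, 11\<close>.
\<close>
definition scaled_coeffs :: "int list" where
  "scaled_coeffs = [2709630, 1354815, 2310000, 1732500, 2079000, 1732500, 1980000, 1732500, 1925000,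
     1732500, 1890000, 1732500]"

lemma scaled_coeffs_max_seq:
  assumes "k \<in> {1..12}"
  shows "1732500 * max_seq k - of_int (scaled_coeffs ! (k - 1))
     = (if k = 1 then 2 else if k = 2 then 1 else 0) * (1732500 * (alpha - 0.782))"
proof -
  have "\<forall>k\<in>set [1..<13]. 1732500 * max_seq k - of_int (scaled_coeffs ! (k - 1))
      = (if k = 1 then 2 else if k = 2 then 1 else 0) * (1732500 * (alpha - 0.782))"
    by (simp add: upt_rec max_seq_def gamma_seq_def scaled_coeffs_def)
  moreover have "k \<in> set [1..<13]" using assms by auto
  ultimately show ?thesis by blast
qed

lemma short_sums_test:
  "list_all (\<lambda>n. nonneg_test 5 (fst (clenshaw (take n scaled_coeffs)))) [3, 4, 6, 7, 8, 9, 10, 11, 12]"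
  by code_simp

lemma two_sin_add_sin_double: "2 * sin x + sin (2 * x) = 2 * (sin x * (1 + cos x))" for x :: real
  unfolding sin_double by (simp add: algebra_simps)

lemma two_sin_add_sin_double_nonneg:
  fixes x :: real
  assumes "0 \<le> x" "x \<le> pi"
  shows "0 \<le> 2 * sin x + sin (2 * x)"
proof -
  have "0 \<le> sin x" "0 \<le> 1 + cos x"
    using assms cos_ge_minus_one[of x] by (auto simp: sin_ge_zero simp del: cos_ge_minus_one)
  then show ?thesis unfolding two_sin_add_sin_double by simp
qed

lemma short_max_sums_nonneg:
  assumes n: "n \<in> {3, 4, 6, 7, 8, 9, 10, 11, 12}" and x: "0 < x" "x < pi"
  shows "0 \<le> (\<Sum>k=1..n. max_seq k * sin (real k * x))"
proof -
  let ?L = "\<lambda>k. of_int (scaled_coeffs ! (k - 1)) :: real"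
  let ?e = "1732500 * (alpha - 0.782)"
  have "n \<in> set [3, 4, 6, 7, 8, 9, 10, 11, 12]" using n by simp
  then have "nonneg_test 5 (fst (clenshaw (take n scaled_coeffs)))"
    using short_sums_test unfolding list_all_iff by blast
  note sine_sum_nonneg_test[OF this x]
  also have "{1..length (take n scaled_coeffs)} = {1..n}"
    using n by (auto simp: scaled_coeffs_def)
  also have "(\<Sum>k=1..n. of_int (take n scaled_coeffs ! (k - 1)) * sin (real k * x))
      = (\<Sum>k=1..n. ?L k * sin (real k * x))"
    by (intro sum.cong) auto
  finally have L: "0 \<le> (\<Sum>k=1..n. ?L k * sin (real k * x))" .
  have "1732500 * (\<Sum>k=1..n. max_seq k * sin (real k * x)) - (\<Sum>k=1..n. ?L k * sin (real k * x))
      = (\<Sum>k=1..n. (1732500 * max_seq k - ?L k) * sin (real k * x))"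
    by (simp add: sum_distrib_left sum_subtractf left_diff_distrib mult.assoc)
  also have "\<dots> = (\<Sum>k=1..n. (if k = 1 then 2 else if k = 2 then 1 else 0) * ?e * sin (real k * x))"
  proof (intro sum.cong refl)
    fix k assume "k \<in> {1..n}"
    then have "k \<in> {1..12}" using n by auto
    then show "(1732500 * max_seq k - ?L k) * sin (real k * x)
        = (if k = 1 then 2 else if k = 2 then 1 else 0) * ?e * sin (real k * x)"
      by (simp only: scaled_coeffs_max_seq)
  qed
  also have "\<dots> = (\<Sum>k\<in>{1, 2}. (if k = 1 then 2 else if k = 2 then 1 else 0) * ?e * sin (real k * x))"
    using n by (intro sum.mono_neutral_right) auto
  also have "\<dots> = ?e * (2 * sin x + sin (2 * x))" by (simp add: algebra_simps)
  also have "0 \<le> \<dots>"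
    using alpha_bounds two_sin_add_sin_double_nonneg[of x] x by (intro mult_nonneg_nonneg) simp_all
  finally show ?thesis using L by simp
qed

section \<open>Long sums\<close>

subsection \<open>A lower bound for the partial sums of the square wave\<close>

definition odd_sine_sum :: "nat \<Rightarrow> real \<Rightarrow> real" where
  "odd_sine_sum m y = (\<Sum>j=1..m. sin ((2 * real j - 1) * y) / (2 * real j - 1))"

lemma odd_cosine_sum:
  "2 * sin y * (\<Sum>j=1..m. cos ((2 * real j - 1) * y)) = sin (2 * real m * y)"
proof (induction m)
  case 0
  show ?case by simp
next
  case (Suc m)
  define w where "w = (2 * real m + 1) * y"
  have "2 * sin y * cos w = sin (w + y) - sin (w - y)"
    by (simp add: sin_add sin_diff)
  with Suc show ?case
    by (simp add: w_def distrib_left) (simp add: algebra_simps)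
qed

text \<open>At \<open>pi/2\<close> the sum is a partial sum of Leibniz' alternating series for \<open>pi/4\<close>.\<close>
lemma odd_sine_sum_pi_half:
  assumes m: "1 \<le> m"
  shows "pi/2 - (1 + (-1) ^ m) / (2 * real m) \<le> 2 * odd_sine_sum m (pi/2)"
proof -
  define s where "s m = (\<Sum>i<m. (-1) ^ i * (1 / real (i * 2 + 1)))" for m
  have J: "odd_sine_sum m (pi/2) = s m"
    unfolding odd_sine_sum_def s_def
  proof (rule sum.reindex_bij_witness[of _ "\<lambda>i. i + 1" "\<lambda>j. j - 1"])
    fix j assume "j \<in> {1..m}"
    then obtain i where j: "j = Suc i" by (cases j) auto
    have arg: "(2 * real j - 1) * (pi/2) = pi/2 + real i * pi" by (simp add: j algebra_simps)
    have "sin ((2 * real j - 1) * (pi/2)) = (-1) ^ i"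
      unfolding arg sin_add by simp
    then show "(-1) ^ (j - 1) * (1 / real ((j - 1) * 2 + 1)) = sin ((2 * real j - 1) * (pi/2)) / (2 * real j - 1)"
      by (simp add: j add.commute mult.commute)
  qed auto
  have zero: "(\<lambda>n. 1 / real (n * 2 + 1)) \<longlonglongrightarrow> 0" and mono: "monoseq (\<lambda>n. 1 / real (n * 2 + 1))"
    using zeroseq_arctan_series[of 1] monoseq_arctan_series[of 1] by simp_all
  have upper: "pi/4 \<le> s (2*n + 1)" for n
  proof -
    have "pi/4 = (\<Sum>i. (-1) ^ i * (1 / real (i * 2 + 1)))" using pi_series by simp
    also have "\<dots> \<le> s (2*n + 1)"
      using summable_Leibniz(2)[OF zero mono] unfolding s_def by auto
    finally show ?thesis .
  qed
  have "pi/4 - (1 + (-1) ^ m) / (4 * real m) \<le> s m"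
  proof (cases "even m")
    case True
    then obtain n where n: "m = 2 * n" by blast
    then have "pi/4 \<le> s m + 1 / real (m * 2 + 1)"
      using upper[of n] by (simp add: s_def)
    moreover have "1 / real (m * 2 + 1) \<le> 1 / real (m * 2)"
      using m by (intro divide_left_mono) simp_all
    moreover have "(1 + (-1) ^ m) / (4 * real m) = 1 / real (m * 2)"
      using True m by (simp add: field_simps)
    ultimately show ?thesis by linarith
  next
    case False
    then show ?thesis using upper[of "m div 2"] by simp
  qed
  moreover have "(1 + (-1) ^ m) / (2 * real m) = 2 * ((1 + (-1) ^ m) / (4 * real m))"
    using m by (simp add: field_simps)
  ultimately show ?thesis unfolding J by linarith
qed

text \<open>
  For large \<open>m\<close> the sum is close to the square wave \<open>pi/4\<close>, with an error of about
  \<open>- cos (2*m*y) / (4*m*sin y)\<close>.  Enlarging the error by \<open>1/(4*m*sin y)\<close> makes the difference of both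
  sides monotone: in its derivative the oscillating terms of highest order cancel, and what is left
  has the sign of \<open>- cos y\<close>.  So on the left half of the interval it suffices to compare at
  \<open>pi/2\<close>, and the right half follows by symmetry.
\<close>
lemma odd_sine_sum_ge:
  assumes m: "1 \<le> m" and y: "0 < y" "y < pi"
  shows "pi/2 - (1 + cos (2 * real m * y)) / (2 * real m * sin y) \<le> 2 * odd_sine_sum m y"
proof -
  define D where "D z = 2 * odd_sine_sum m z + (1 + cos (2 * real m * z)) / (2 * real m * sin z)" for z
  have odd: "2 * real j \<noteq> 1" for j
  proof
    assume "2 * real j = 1"
    then have "real (2 * j) = real 1" by simp
    then have "2 * j = 1" by (simp only: of_nat_eq_iff)
    then show False by presburger
  qed
  have half: "pi/2 \<le> D z" if z: "0 < z" "z \<le> pi/2" for z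
  proof -
    have deriv: "\<exists>d. (D has_real_derivative d) (at v) \<and> d \<le> 0" if v: "z \<le> v" "v \<le> pi/2" for v
    proof -
      have s: "0 < sin v" and c: "0 \<le> cos v"
        using z v by (auto intro!: sin_gt_zero cos_ge_zero)
      define C where "C = (\<Sum>j=1..m. cos ((2 * real j - 1) * v))"
      have C: "2 * C = sin (2 * real m * v) / sin v"
        using odd_cosine_sum[of v m] s by (simp add: C_def field_simps)
      have "(odd_sine_sum m has_real_derivative C) (at v)"
        unfolding odd_sine_sum_def C_def
        by (rule DERIV_sum) (auto intro!: derivative_eq_intros simp: odd)
      then have "(D has_real_derivative
          2 * C + ((0 + - sin (2 * real m * v) * (2 * real m)) * (2 * real m * sin v)
             - (1 + cos (2 * real m * v)) * (2 * real m * cos v)) / ((2 * real m * sin v) * (2 * real m * sin v))) (at v)"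
        unfolding D_def using m s by (auto intro!: derivative_eq_intros)
      also have "2 * C + ((0 + - sin (2 * real m * v) * (2 * real m)) * (2 * real m * sin v)
             - (1 + cos (2 * real m * v)) * (2 * real m * cos v)) / ((2 * real m * sin v) * (2 * real m * sin v))
          = - ((1 + cos (2 * real m * v)) * cos v / (2 * real m * (sin v)\<^sup>2))"
        unfolding C using m s by (simp add: field_simps power2_eq_square)
      finally have "(D has_real_derivative - ((1 + cos (2 * real m * v)) * cos v / (2 * real m * (sin v)\<^sup>2))) (at v)" .
      moreover have "0 \<le> (1 + cos (2 * real m * v)) * cos v / (2 * real m * (sin v)\<^sup>2)"
      proof (intro divide_nonneg_nonneg mult_nonneg_nonneg)
        show "0 \<le> 1 + cos (2 * real m * v)" using cos_ge_minus_one[of "2 * real m * v"] by linarith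
      qed (use c in simp_all)
      then have "- ((1 + cos (2 * real m * v)) * cos v / (2 * real m * (sin v)\<^sup>2)) \<le> 0" by linarith
      ultimately show ?thesis by blast
    qed
    have "D (pi/2) \<le> D z"
      by (rule DERIV_nonpos_imp_nonincreasing[OF z(2) deriv])
    moreover have "2 * real m * (pi/2) = real m * pi" by simp
    then have "cos (2 * real m * (pi/2)) = (-1) ^ m" by (simp only: cos_npi)
    then have "pi/2 \<le> D (pi/2)" using odd_sine_sum_pi_half[OF m] by (simp add: D_def algebra_simps)
    ultimately show ?thesis by linarith
  qed
  have "pi/2 \<le> D y"
  proof (cases "y \<le> pi/2")
    case True
    then show ?thesis using half y by simp
  next
    case False
    have "odd_sine_sum m (pi - y) = odd_sine_sum m y"
      unfolding odd_sine_sum_def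
    proof (intro sum.cong refl)
      fix j assume "j \<in> {1..m}"
      have "sin ((2 * real j - 1) * (pi - y)) = sin (real (2*j) * pi - (pi + (2 * real j - 1) * y))"
        by (simp add: algebra_simps)
      also have "\<dots> = sin ((2 * real j - 1) * y)"
        unfolding sin_diff by (simp add: sin_npi cos_npi del: of_nat_mult)
      finally show "sin ((2 * real j - 1) * (pi - y)) / (2 * real j - 1) = sin ((2 * real j - 1) * y) / (2 * real j - 1)"
        by simp
    qed
    moreover have "cos (2 * real m * (pi - y)) = cos (2 * real m * y)"
    proof -
      have "2 * real m * (pi - y) = real (2*m) * pi - 2 * real m * y" by (simp add: algebra_simps)
      then show ?thesis by (simp add: cos_diff sin_npi cos_npi del: of_nat_mult)
    qed
    ultimately have "D (pi - y) = D y" by (simp add: D_def)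
    then show ?thesis using half[of "pi - y"] False y by simp
  qed
  then show ?thesis unfolding D_def by linarith
qed

subsection \<open>Closed forms\<close>

lemma alternating_sine_sum:
  assumes "sin y \<noteq> 0"
  shows "(\<Sum>j=1..m. sin ((2 * real j - 1) * y) - sin (2 * real j * y))
     = ((1 - cos y) / sin y * (1 - cos (2 * real m * y)) - sin (2 * real m * y)) / 2"
proof (induction m)
  case 0
  show ?case by simp
next
  case (Suc m)
  define w where "w = (2 * real m + 1) * y"
  define t where "t = (1 - cos y) / sin y"
  have t: "1 - cos y = t * sin y" using assms by (simp add: t_def)
  have args: "(2 * real (Suc m) - 1) * y = w" "2 * real (Suc m) * y = w + y" "2 * real m * y = w - y"
    by (simp_all add: w_def algebra_simps)
  have "2 * (sin w - sin (w + y)) = 2 * sin w * (1 - cos y) - 2 * cos w * sin y"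
    by (simp add: sin_add algebra_simps)
  also have "\<dots> = t * (cos (w - y) - cos (w + y)) + (sin (w - y) - sin (w + y))"
    unfolding t by (simp add: cos_add cos_diff sin_add sin_diff algebra_simps)
  finally have "2 * (sin w - sin (w + y)) = t * (cos (w - y) - cos (w + y)) + (sin (w - y) - sin (w + y))" .
  moreover have "(\<Sum>j=1..m. sin ((2 * real j - 1) * y) - sin (2 * real j * y)) = (t * (1 - cos (w - y)) - sin (w - y)) / 2"
    using Suc unfolding args t_def .
  moreover have "(\<Sum>j=1..Suc m. sin ((2 * real j - 1) * y) - sin (2 * real j * y))
      = (\<Sum>j=1..m. sin ((2 * real j - 1) * y) - sin (2 * real j * y)) + (sin w - sin (w + y))"
    by (simp only: sum.cl_ivl_Suc args) simp
  ultimately show ?case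
    unfolding args t_def[symmetric] by (simp add: algebra_simps)
qed

lemma sin_reflect:
  "sin (real (2*j) * (pi - y)) = - sin (2 * real j * y)"
  "1 \<le> j \<Longrightarrow> sin (real (2*j - 1) * (pi - y)) = sin ((2 * real j - 1) * y)"
proof -
  have "real (2*j) * (pi - y) = real (2*j) * pi - 2 * real j * y" by (simp add: algebra_simps)
  then show "sin (real (2*j) * (pi - y)) = - sin (2 * real j * y)"
    by (simp add: sin_diff sin_npi cos_npi del: of_nat_mult)
  assume "1 \<le> j"
  then have "real (2*j - 1) * (pi - y) = real (2*j) * pi - (pi + (2 * real j - 1) * y)"
    by (simp add: of_nat_diff algebra_simps)
  then show "sin (real (2*j - 1) * (pi - y)) = sin ((2 * real j - 1) * y)"
    unfolding sin_diff by (simp add: sin_npi cos_npi sin_diff del: of_nat_mult)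
qed

lemma sum_pairs:
  fixes f :: "nat \<Rightarrow> real"
  shows "(\<Sum>k=1..2*m. f k) = (\<Sum>j=1..m. f (2*j - 1) + f (2*j))"
  by (induction m) simp_all

lemma gamma_sum_even:
  assumes "sin y \<noteq> 0"
  shows "2 * (\<Sum>k=1..2*m. gamma_seq k * sin (real k * (pi - y)))
     = (1 - cos y) / sin y * (1 - cos (2 * real m * y)) - sin (2 * real m * y) + 2 * odd_sine_sum m y"
proof -
  have "(\<Sum>k=1..2*m. gamma_seq k * sin (real k * (pi - y)))
      = (\<Sum>j=1..m. (sin ((2 * real j - 1) * y) - sin (2 * real j * y))
           + sin ((2 * real j - 1) * y) / (2 * real j - 1))"
    unfolding sum_pairs
  proof (intro sum.cong refl)
    fix j assume "j \<in> {1..m}"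
    then have j: "1 \<le> j" by simp
    have "gamma_seq (2*j - 1) = 1 + 1 / (2 * real j - 1)" "gamma_seq (2*j) = 1"
      using j by (auto simp: gamma_seq_def of_nat_diff field_simps)
    then show "gamma_seq (2*j - 1) * sin (real (2*j - 1) * (pi - y)) + gamma_seq (2*j) * sin (real (2*j) * (pi - y))
        = (sin ((2 * real j - 1) * y) - sin (2 * real j * y)) + sin ((2 * real j - 1) * y) / (2 * real j - 1)"
      unfolding sin_reflect(1) sin_reflect(2)[OF j] by (simp add: algebra_simps)
  qed
  then show ?thesis
    unfolding sum.distrib alternating_sine_sum[OF assms] odd_sine_sum_def by (simp add: field_simps)
qed

lemma gamma_sum_odd:
  assumes "sin y \<noteq> 0" and m: "1 \<le> m"
  shows "2 * (\<Sum>k=1..2*m - 1. gamma_seq k * sin (real k * (pi - y)))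
     = (1 - cos y) / sin y * (1 - cos (2 * real m * y)) + sin (2 * real m * y) + 2 * odd_sine_sum m y"
proof -
  have "{1..2*m} = insert (2*m) {1..2*m - 1}" using m by auto
  then have "(\<Sum>k=1..2*m. gamma_seq k * sin (real k * (pi - y)))
      = gamma_seq (2*m) * sin (real (2*m) * (pi - y)) + (\<Sum>k=1..2*m - 1. gamma_seq k * sin (real k * (pi - y)))"
    using m by (simp del: of_nat_mult)
  then show ?thesis
    using gamma_sum_even[OF assms(1), of m] unfolding sin_reflect(1) by (simp add: gamma_seq_def)
qed

lemma max_sum_eq:
  assumes "2 \<le> n"
  shows "(\<Sum>k=1..n. max_seq k * sin (real k * x))
     = (\<Sum>k=1..n. gamma_seq k * sin (real k * x)) - (1 - alpha) * (2 * sin x + sin (2 * x))"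
proof -
  have "(\<Sum>k=1..n. gamma_seq k * sin (real k * x)) - (\<Sum>k=1..n. max_seq k * sin (real k * x))
      = (\<Sum>k=1..n. (gamma_seq k - max_seq k) * sin (real k * x))"
    by (simp add: sum_subtractf left_diff_distrib)
  also have "\<dots> = (\<Sum>k\<in>{1, 2}. (gamma_seq k - max_seq k) * sin (real k * x))"
    using assms by (intro sum.mono_neutral_right) (auto simp: max_seq_def)
  also have "\<dots> = (1 - alpha) * (2 * sin x + sin (2 * x))"
    by (simp add: max_seq_def gamma_seq_def algebra_simps)
  finally show ?thesis by simp
qed

subsection \<open>Both ends of the interval\<close>

text \<open>
  The quotient \<open>sin (k*y) / k\<close> does not increase with \<open>k\<close>.  With denominators cleared, the difference
  of both sides grows from \<open>k - 1\<close> to \<open>k\<close> by \<open>2*k * sin (k*y) * (1 - cos y) \<ge> 0\<close>.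
\<close>
lemma sin_quotient_antimono:
  assumes "0 \<le> y" and "real k * y \<le> pi"
  shows "real k * sin (real (Suc k) * y) \<le> real (Suc k) * sin (real k * y)"
  using assms(2)
proof (induction k)
  case 0
  show ?case by simp
next
  case (Suc k)
  let ?w = "real (Suc k) * y"
  have "real k * y \<le> ?w" using assms(1) by (simp add: distrib_right)
  then have IH: "real k * sin ?w \<le> real (Suc k) * sin (real k * y)"
    using Suc by simp
  have "0 \<le> sin ?w" using Suc.prems assms(1) by (intro sin_ge_zero) simp_all
  then have "0 \<le> 2 * real (Suc k) * (sin ?w * (1 - cos y))"
    by (intro mult_nonneg_nonneg) simp_all
  moreover have "sin (real (Suc (Suc k)) * y) = sin (?w + y)" "sin (real k * y) = sin (?w - y)"
    by (simp_all add: algebra_simps)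
  then have "sin (real (Suc (Suc k)) * y) = 2 * (sin ?w * cos y) - sin (real k * y)"
    by (simp add: sin_add sin_diff)
  then have "real (Suc k) * sin (real (Suc (Suc k)) * y)
      = 2 * real (Suc k) * (sin ?w * cos y) - real (Suc k) * sin (real k * y)"
    by (simp only: right_diff_distrib mult.left_commute[of _ 2] mult.assoc)
  moreover have "2 * real (Suc k) * (sin ?w * (1 - cos y))
      = 2 * real (Suc k) * sin ?w - 2 * real (Suc k) * (sin ?w * cos y)"
    by (simp only: right_diff_distrib mult_1_right)
  moreover have "2 * real (Suc k) * sin ?w = real k * sin ?w + real (Suc (Suc k)) * sin ?w"
    by (simp only: flip: distrib_right) simp
  ultimately show ?case using IH by linarith
qed

text \<open>
  Close to \<open>pi\<close> the terms of a sum are grouped in pairs.  Up to a positive factor the \<open>j\<close>-th pair is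
  \<open>sin ((2*j - 1)*y) / (2*j - 1) - sin (2*j*y) / (2*j)\<close> with \<open>y = pi - x\<close>.
\<close>
lemma max_sum_nonneg_right:
  assumes y: "0 \<le> y" and m: "1 \<le> m" and my: "2 * real m * y \<le> pi" and n: "n = 2*m \<or> n = 2*m - 1"
  shows "0 \<le> (\<Sum>k=1..n. max_seq k * sin (real k * (pi - y)))"
proof -
  let ?f = "\<lambda>k. max_seq k * sin (real k * (pi - y))"
  have le: "2 * real j * y \<le> pi" if "j \<le> m" for j
    using that my y by (intro order_trans[OF _ my] mult_right_mono) simp_all
  have pair: "0 \<le> ?f (2*j - 1) + ?f (2*j)" if j: "1 \<le> j" "j \<le> m" for j
  proof -
    obtain c where c: "0 \<le> c" "max_seq (2*j) = c" "max_seq (2*j - 1) = c * (2 * real j) / (2 * real j - 1)"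
    proof (cases "j = 1")
      case True
      then show thesis using that[of alpha] alpha_bounds by (simp add: max_seq_simps)
    next
      case False
      then show thesis using that[of 1] j by (simp add: max_seq_simps)
    qed
    have "real (2*j - 1) * sin (real (Suc (2*j - 1)) * y) \<le> real (Suc (2*j - 1)) * sin (real (2*j - 1) * y)"
      using y le[OF j(2)] j by (intro sin_quotient_antimono) (auto simp: of_nat_diff left_diff_distrib)
    then have "(2 * real j - 1) * sin (2 * real j * y) \<le> 2 * real j * sin ((2 * real j - 1) * y)"
      using j by (simp add: of_nat_diff)
    then have "sin (2 * real j * y) \<le> 2 * real j / (2 * real j - 1) * sin ((2 * real j - 1) * y)"
      using j by (simp add: field_simps)
    then have "0 \<le> c * (2 * real j / (2 * real j - 1) * sin ((2 * real j - 1) * y) - sin (2 * real j * y))"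
      using c(1) by simp
    then show ?thesis
      unfolding sin_reflect(1) sin_reflect(2)[OF j(1)] c(2,3) by (simp add: algebra_simps)
  qed
  show ?thesis
  proof (cases "n = 2*m")
    case True
    have "0 \<le> (\<Sum>j=1..m. ?f (2*j - 1) + ?f (2*j))" by (intro sum_nonneg pair) auto
    then show ?thesis unfolding True sum_pairs .
  next
    case False
    obtain l where l: "m = Suc l" using m by (cases m) auto
    then have n': "n = Suc (2*l)" using n False by simp
    have "0 \<le> (\<Sum>j=1..l. ?f (2*j - 1) + ?f (2*j))" by (intro sum_nonneg pair) (auto simp: l)
    then have "0 \<le> (\<Sum>k=1..2*l. ?f k)" unfolding sum_pairs .
    moreover have "0 \<le> ?f (2*m - 1)"
    proof (intro mult_nonneg_nonneg)
      show "0 \<le> max_seq (2*m - 1)" using positive_max_seq m by (auto simp: positive_seq_def intro: less_imp_le)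
      have "0 \<le> sin ((2 * real m - 1) * y)"
        using y m my mult_right_mono[of 1 "2 * real m" y] by (intro sin_ge_zero) (auto simp: left_diff_distrib)
      then show "0 \<le> sin (real (2*m - 1) * (pi - y))" unfolding sin_reflect(2)[OF m] .
    qed
    then have "0 \<le> ?f (Suc (2*l))" by (simp add: l)
    ultimately show ?thesis unfolding n' by simp
  qed
qed

lemma max_sum_nonneg_left:
  assumes "0 \<le> x" and "real n * x \<le> pi"
  shows "0 \<le> (\<Sum>k=1..n. max_seq k * sin (real k * x))"
proof (intro sum_nonneg mult_nonneg_nonneg)
  fix k assume k: "k \<in> {1..n}"
  then show "0 \<le> max_seq k" using positive_max_seq by (auto simp: positive_seq_def intro: less_imp_le)
  have "real k * x \<le> real n * x" using k assms(1) by (intro mult_right_mono) auto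
  then show "0 \<le> sin (real k * x)" using assms by (intro sin_ge_zero) auto
qed


subsection \<open>The middle of the interval\<close>

text \<open>
  The polynomial is a multiple of \<open>28*t*(1 + t\<^sup>2)\<^sup>4\<close> times the right minus the left-hand side of
  \<open>1 + (t + e)\<^sup>2 \<le> (1.57 + t - e - 3.48*t\<^sup>3/(1 + t\<^sup>2)\<^sup>2)\<^sup>2\<close> at \<open>e = (1 + t\<^sup>2)/(28*t)\<close>, written in \<open>10*t\<close> to
  have integer coefficients.
\<close>
definition middle_poly :: "int list" where
  "middle_poly = [-7850000000000, 9254300000000, 1805500000000, 377572000000, 3579600000, 802580000,
     -289508000, 23570000, 750460, -417257, 21195, -100]"

lemma middle_poly_nonneg:
  assumes "1/10 < t" "t \<le> 10"
  shows "0 \<le> peval middle_poly (10 * t)"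
proof -
  (* 10*t = 1 + 99*u maps the unit interval onto the range of t *)
  have "nonneg_test 4 (psubst 1 99 middle_poly)" by code_simp
  then have "0 \<le> peval (psubst 1 99 middle_poly) ((10*t - 1)/99)"
    using assms by (intro nonneg_test_sound) auto
  moreover have "1 + 99 * ((10*t - 1)/99) = 10 * t" by (simp add: field_simps)
  ultimately show ?thesis unfolding peval_psubst by (simp only: of_int_1 of_int_numeral)
qed

lemma middle_poly_eq:
  fixes t :: real
  shows "peval middle_poly (10 * t) = 250000000 *
     (28*t * (157*(1 + t^2)^2 - 348*t^3)^2
      + 200*(157*(1 + t^2)^2 - 348*t^3) * (1 + t^2)^2 * (27*t^2 - 1)
      - 40000*t*(1 + t^2)^5 - 280000*t*(1 + t^2)^4)"
  unfolding middle_poly_def by (simp add: algebra_simps power_numeral_reduce)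

text \<open>
  In the application \<open>t = tan (y/2)\<close>, so that \<open>R = 4 * 0.2175 * sin y * (1 - cos y)\<close> with
  \<open>0.2175 > 1 - alpha\<close>, and \<open>e = 1/(2*m*sin y)\<close>.  Of the three upper bounds on \<open>e\<close> the first comes
  from \<open>m \<ge> 7\<close>, and the others come from the distance \<open>pi/(2*m)\<close> of \<open>y\<close> to \<open>0\<close> and to \<open>pi\<close>.  The second
  inequality follows from the first bound for \<open>1/10 < t \<le> 10\<close>, where it is nearly sharp; for smaller and
  for larger \<open>t\<close> crude estimates with the other two bounds are enough.
\<close>
lemma middle_inequality:
  fixes t e :: real
  assumes t: "0 < t" and e: "0 \<le> e" "e \<le> (1 + t^2) / (28*t)" "e \<le> (1 + t^2) / 3.14" "e \<le> (1 + t^2) / (3.14 * t^2)"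
  defines "R \<equiv> 3.48*t^3 / (1 + t^2)^2"
  defines "K \<equiv> 1.57 + t - e - R"
  shows "0 \<le> K" and "1 + (t + e)^2 \<le> K^2"
proof -
  have q: "0 < 1 + t^2" using t by (simp add: add_pos_nonneg)
  (* from 2*t <= 1 + t^2 *)
  have R1: "R \<le> 0.87*t"
  proof -
    have "(2*t)^2 \<le> (1 + t^2)^2"
      using t sum_squares_bound[of t 1] by (intro power_mono) auto
    then have "t * (4 * t^2) \<le> t * (1 + t^2)^2"
      using t by (intro mult_left_mono) (simp_all add: power_mult_distrib)
    then have "3.48*t^3 \<le> 0.87*t * (1 + t^2)^2" by (simp add: power3_eq_cube power2_eq_square)
    then show ?thesis unfolding R_def using q by (subst pos_divide_le_eq) simp_all
  qed
  have R2: "R \<le> 3.48/t"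
  proof -
    have "(t^2)^2 \<le> (1 + t^2)^2" by (intro power_mono) auto
    then have "3.48*t^3 * t \<le> 3.48 * (1 + t^2)^2" by (simp add: power3_eq_cube power2_eq_square)
    then show ?thesis unfolding R_def using q t by (simp add: pos_divide_le_eq pos_le_divide_eq)
  qed
  show K: "0 \<le> K"
  proof (cases "t \<le> 1/10")
    case True
    then have "t^2 \<le> (1/10)^2" using t by (intro power_mono) auto
    then show ?thesis using e(3) R1 t by (simp add: K_def power2_eq_square)
  next
    case False
    have "(1 + t^2) / (28*t) = 1/(28*t) + t/28" using t by (simp add: field_simps power2_eq_square)
    moreover have "1/(28*t) \<le> 1/2.8" using False by (intro divide_left_mono) auto
    ultimately show ?thesis using e(2) R1 t by (simp add: K_def)
  qed
  consider "t \<le> 1/10" | "1/10 < t" "t \<le> 10" | "10 < t" by linarith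
  then show "1 + (t + e)^2 \<le> K^2"
  proof cases
    case 1
    then have "t^2 \<le> (1/10)^2" using t by (intro power_mono) auto
    then have e': "e \<le> 0.33" using e(3) by (simp add: power2_eq_square)
    have "(t + e)^2 \<le> 0.43^2" using e(1) e' 1 t by (intro power_mono) auto
    moreover have "1.24^2 \<le> K^2" using e' R1 t by (intro power_mono) (auto simp: K_def)
    ultimately show ?thesis by (simp add: power_divide)
  next
    case 3
    have "1 / t^2 \<le> 1 / 10^2" using 3 by (intro divide_left_mono power_mono) auto
    note e(4)
    also have "(1 + t^2) / (3.14 * t^2) = (1 / t^2 + 1) / 3.14" using t by (simp add: field_simps)
    also have "\<dots> \<le> (1 / 10^2 + 1) / 3.14"
      by (intro divide_right_mono add_right_mono) (fact, simp)
    finally have e': "e \<le> 0.33" by simp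
    have "3.48/t \<le> 3.48/10" using 3 by (intro divide_left_mono) auto
    then have "(t + 0.89)^2 \<le> K^2" using R2 e' t by (intro power_mono) (auto simp: K_def)
    moreover have "(t + e)^2 \<le> (t + 0.33)^2" using e(1) e' t by (intro power_mono) auto
    ultimately show ?thesis using 3 by (simp add: power2_eq_square algebra_simps)
  next
    case 2
    (* K decreases with e and t + e increases, so it is enough to treat the largest e *)
    define d where "d = (1 + t^2) / (28*t)"
    define L where "L = 1.57 - R"
    define M where "M = 157*(1 + t^2)^2 - 348*t^3"
    have "L * (1 + t^2)^2 = 1.57*(1 + t^2)^2 - 3.48*t^3"
      using q by (simp add: L_def R_def left_diff_distrib)
    then have M: "M = 100 * L * (1 + t^2)^2" by (simp add: M_def)
    have d: "28*t*d = 1 + t^2" using t by (simp add: d_def)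
    have "10000 * (28*t*(1 + t^2)^4) * ((L + t - d)^2 - (1 + (t + d)^2))
        = 10000 * (1 + t^2)^4 * (28*t*L^2 + 2*L*(28*t*t - 28*t*d) - 4*t*(28*t*d) - 28*t)"
      by (simp add: algebra_simps power2_eq_square)
    also have "\<dots> = 28*t*M^2 + 200*M*(1 + t^2)^2*(27*t^2 - 1) - 40000*t*(1 + t^2)^5 - 280000*t*(1 + t^2)^4"
      unfolding d M by (simp add: power_mult_distrib power2_eq_square power_numeral_reduce algebra_simps)
    also have "0 \<le> \<dots>"
      using middle_poly_nonneg[OF 2] unfolding middle_poly_eq M_def by simp
    finally have prod: "0 \<le> 10000 * (28*t*(1 + t^2)^4) * ((L + t - d)^2 - (1 + (t + d)^2))" .
    have "1 + (t + d)^2 \<le> (L + t - d)^2"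
    proof (rule ccontr)
      assume "\<not> ?thesis"
      moreover have "0 < 10000 * (28*t*(1 + t^2)^4)" using t q by simp
      ultimately have "10000 * (28*t*(1 + t^2)^4) * ((L + t - d)^2 - (1 + (t + d)^2)) < 0"
        by (intro mult_pos_neg) simp_all
      with prod show False by linarith
    qed
    moreover have "0 \<le> L + t - d"
    proof -
      have "d = 1/(28*t) + t/28" using t by (simp add: d_def field_simps power2_eq_square)
      moreover have "1/(28*t) \<le> 1/2.8" using 2 by (intro divide_left_mono) auto
      ultimately show ?thesis using R1 t by (simp add: L_def)
    qed
    then have "(L + t - d)^2 \<le> K^2"
      using e(2) by (intro power_mono) (auto simp: K_def L_def d_def)
    moreover have "(t + e)^2 \<le> (t + d)^2"
      using e(1,2) t by (intro power_mono) (auto simp: d_def)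
    ultimately show ?thesis by linarith
  qed
qed

text \<open>
  The half-angle substitution, together with \<open>y \<le> 2 * tan (y/2) = 2*t\<close> and, by reflection,
  \<open>pi - y \<le> 2/t\<close>.  Since \<open>1/sin y = (1 + t\<^sup>2)/(2*t)\<close>, every upper bound for \<open>1/(2*m)\<close> turns into one for
  \<open>e\<close>.
\<close>
lemma middle_bounds:
  assumes y: "0 < y" "y < pi" and m: "7 \<le> m" and left: "pi \<le> 2 * real m * y" and right: "pi \<le> 2 * real m * (pi - y)"
  defines "t \<equiv> (1 - cos y) / sin y" and "e \<equiv> 1 / (2 * real m * sin y)"
  shows "0 < t" "0 \<le> e" "e \<le> (1 + t^2) / (28*t)" "e \<le> (1 + t^2) / 3.14" "e \<le> (1 + t^2) / (3.14 * t^2)"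
    and "3.48*t^3 / (1 + t^2)^2 = 0.87 * (sin y * (1 - cos y))"
proof -
  define r where "r = 1 / (2 * real m)"
  have s: "0 < sin y" using y by (intro sin_gt_zero)
  have c: "cos y < 1" "-1 < cos y"
    using cos_monotone_0_pi[of 0 y] cos_monotone_0_pi[of y pi] y by simp_all
  show t: "0 < t" using s c by (simp add: t_def)
  have ts: "t * sin y = 1 - cos y" using s by (simp add: t_def)
  have "(sin y)^2 * (1 + t^2) = (sin y)^2 + (t * sin y)^2" by (simp add: power_mult_distrib algebra_simps)
  also have "\<dots> = 2 * (1 - cos y)"
    unfolding ts sin_squared_eq by (simp add: power2_eq_square algebra_simps)
  also have "\<dots> = sin y * (2 * t)" by (simp flip: ts)
  finally have q: "sin y * (1 + t^2) = 2 * t" using s by (simp add: power2_eq_square)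
  have q0: "0 < 1 + t^2" by (simp add: add_pos_nonneg)
  have sin_y: "sin y = 2 * t / (1 + t^2)" using q q0 by (simp add: field_simps)
  have e: "e = r * ((1 + t^2) / (2 * t))"
    unfolding e_def sin_y r_def by simp
  have tan: "tan (y/2) = t"
  proof -
    have "tan (y/2) = sin y / (cos y + 1)" using tan_half[of "y/2"] by simp
    also have "\<dots> = t"
      using sin_cos_squared_add[of y] s c by (simp add: t_def field_simps power2_eq_square)
    finally show ?thesis .
  qed
  have y_le: "y \<le> 2 * t"
    using abs_tan_ge[of "y/2"] y t by (simp add: tan)
  have x_le: "pi - y \<le> 2 / t"
  proof -
    have "tan ((pi - y)/2) = 1 / t"
      using tan_cot[of "y/2"] by (simp add: tan diff_divide_distrib inverse_eq_divide)
    moreover have "\<bar>(pi - y)/2\<bar> \<le> \<bar>tan ((pi - y)/2)\<bar>" using y by (intro abs_tan_ge) simp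
    ultimately show ?thesis using y t by simp
  qed
  have r: "0 < r" "r \<le> 1/14" using m by (simp_all add: r_def field_simps)
  have pi: "3.14 \<le> pi" using pi_approx(1) by simp
  have r_bound: "r \<le> z / 3.14" if "pi \<le> 2 * real m * z" for z
    using that pi m by (simp add: r_def field_simps)
  have r': "r \<le> 2 * t / 3.14" "r \<le> (2 / t) / 3.14"
    using r_bound[OF left] r_bound[OF right] y_le x_le by (auto intro: order_trans divide_right_mono)
  have mono: "e \<le> z * ((1 + t^2) / (2 * t))" if "r \<le> z" for z
    unfolding e using that t q0 by (intro mult_right_mono) auto
  show "0 \<le> e" using s by (simp add: e_def)
  show "e \<le> (1 + t^2) / (28*t)" using mono[OF r(2)] by simp
  show "e \<le> (1 + t^2) / 3.14" using mono[OF r'(1)] t by simp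
  show "e \<le> (1 + t^2) / (3.14 * t^2)" using mono[OF r'(2)] t by (simp add: field_simps power2_eq_square)
  have "sin y * (1 - cos y) = t * (sin y)^2" by (simp add: power2_eq_square flip: ts)
  then show "3.48*t^3 / (1 + t^2)^2 = 0.87 * (sin y * (1 - cos y))"
    unfolding sin_y by (simp add: power_divide power2_eq_square power3_eq_cube)
qed

text \<open>
  With \<open>w = 2*m*y\<close>, the closed forms and the bound for the square wave give twice the sum the lower
  bound \<open>pi/2 + (t - e) - (t + e) * cos w \<plusminus> sin w\<close>, where the sign depends on the parity of \<open>n\<close>.
  By Cauchy-Schwarz the oscillating part is at most \<open>sqrt (1 + (t + e)\<^sup>2)\<close> for both signs.
\<close>
lemma long_max_sum_nonneg:
  assumes m: "7 \<le> m" and n: "n = 2*m \<or> n = 2*m - 1" and x: "0 < x" "x < pi"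
  shows "0 \<le> (\<Sum>k=1..n. max_seq k * sin (real k * x))"
proof -
  define y where "y = pi - x"
  have y: "0 < y" "y < pi" and xy: "x = pi - y" using x by (simp_all add: y_def)
  consider "2 * real m * y \<le> pi" | "2 * real m * x \<le> pi" | "pi \<le> 2 * real m * y" "pi \<le> 2 * real m * (pi - y)"
    unfolding xy by linarith
  then show ?thesis
  proof cases
    case 1
    then show ?thesis using max_sum_nonneg_right[of y m n] y m n by (simp add: xy)
  next
    case 2
    have "real n * x \<le> 2 * real m * x" using n x by (intro mult_right_mono) auto
    then have "real n * x \<le> pi" using 2 by linarith
    then show ?thesis using x by (intro max_sum_nonneg_left) auto
  next
    case 3
    define t where "t = (1 - cos y) / sin y"
    define e where "e = 1 / (2 * real m * sin y)"
    define K where "K = 1.57 + t - e - 3.48*t^3 / (1 + t^2)^2"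
    note b = middle_bounds[OF y m 3, folded t_def e_def]
    have K: "0 \<le> K" "1 + (t + e)^2 \<le> K^2"
      unfolding K_def using middle_inequality[OF b(1-5)] by blast+
    define u where "u = cos (2 * real m * y)"
    define v where "v = (if n = 2*m then - sin (2 * real m * y) else sin (2 * real m * y))"
    have uv: "u^2 + v^2 = 1" by (simp add: u_def v_def)
    have "sin y \<noteq> 0" using sin_gt_zero[OF y] by simp
    then have "2 * (\<Sum>k=1..n. gamma_seq k * sin (real k * x)) = t * (1 - u) + v + 2 * odd_sine_sum m y"
      using gamma_sum_even[of y m] gamma_sum_odd[of y m] n m unfolding t_def u_def v_def xy by auto
    moreover have "pi/2 - (1 + u) * e \<le> 2 * odd_sine_sum m y"
      using odd_sine_sum_ge[of m y] y m by (simp add: u_def e_def)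
    moreover have "(t + e) * u - v \<le> K"
    proof (rule power2_le_imp_le)
      have "((t + e) * u - v)^2 \<le> ((t + e) * u - v)^2 + (u + (t + e) * v)^2" by simp
      also have "\<dots> = (1 + (t + e)^2) * (u^2 + v^2)"
        by (simp add: power2_eq_square algebra_simps)
      also have "\<dots> \<le> K^2" unfolding uv using K(2) by simp
      finally show "((t + e) * u - v)^2 \<le> K^2" .
    qed (rule K(1))
    moreover have "1.57 \<le> pi/2" using pi_approx(1) by simp
    ultimately have "3.48*t^3 / (1 + t^2)^2 \<le> 2 * (\<Sum>k=1..n. gamma_seq k * sin (real k * x))"
      by (simp add: K_def algebra_simps)
    moreover have "2 * ((1 - alpha) * (2 * sin x + sin (2 * x))) \<le> 3.48*t^3 / (1 + t^2)^2"
    proof -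
      have "2 * ((1 - alpha) * (2 * sin x + sin (2 * x))) = 4 * (1 - alpha) * (sin y * (1 - cos y))"
        unfolding two_sin_add_sin_double by (simp add: xy)
      also have "\<dots> \<le> 0.87 * (sin y * (1 - cos y))"
        using alpha_bounds sin_gt_zero[OF y] by (intro mult_right_mono mult_nonneg_nonneg) auto
      finally show ?thesis unfolding b(6) .
    qed
    moreover have "2 \<le> n" using n m by auto
    ultimately show ?thesis unfolding max_sum_eq[OF \<open>2 \<le> n\<close>] by linarith
  qed
qed

section \<open>Sums of the maximal sequence\<close>

lemma PS_on_max_seq: "PS_on {0..pi} (\<lambda>k x. max_seq k * sin (real k * x))"
  unfolding PS_on_def
proof (intro allI impI ballI)
  fix n :: nat and x :: real assume n: "1 \<le> n" and x: "x \<in> {0..pi}"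
  let ?S = "\<Sum>k=1..n. max_seq k * sin (real k * x)"
  show "0 \<le> ?S"
  proof (cases "x = 0 \<or> x = pi")
    case True
    then show ?thesis by auto
  next
    case False
    then have x: "0 < x" "x < pi" using x by auto
    consider "n \<in> {1, 2}" | "n \<in> {3, 4, 6, 7, 8, 9, 10, 11, 12}" | "n = 5" | "13 \<le> n"
    proof -
      have "n = 1 \<or> n = 2 \<or> n = 3 \<or> n = 4 \<or> n = 5 \<or> n = 6 \<or> n = 7 \<or> n = 8 \<or> n = 9 \<or> n = 10
          \<or> n = 11 \<or> n = 12 \<or> 13 \<le> n"
        using n by presburger
      then show thesis using that by auto
    qed
    then show ?thesis
    proof cases
      case 1
      have "0 \<le> sin x" using x by (intro sin_ge_zero) simp_all
      moreover have "0 \<le> alpha * (2 * sin x + sin (2 * x))"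
        using two_sin_add_sin_double_nonneg[of x] x alpha_bounds by (intro mult_nonneg_nonneg) simp_all
      ultimately show ?thesis
        using 1 alpha_bounds by (auto simp: numeral_2_eq_2 max_seq_def algebra_simps)
    next
      case 2
      then show ?thesis using x by (rule short_max_sums_nonneg)
    next
      case 3
      have "{1..n} = {1, 2, 3, 4, 5}" using 3 by auto
      then have "?S = 2 * alpha * sin x + alpha * sin (2 * x) + gamma_seq 3 * sin (3 * x)
          + gamma_seq 4 * sin (4 * x) + gamma_seq 5 * sin (5 * x)"
        by (simp add: max_seq_def)
      also have "\<dots> = 2/15 * (sin x * quintic_factor alpha (cos x))" by (rule quintic_sum_eq)
      also have "0 \<le> \<dots>"
        using quintic_factor_alpha_nonneg sin_gt_zero[OF x] by simp
      finally show ?thesis .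
    next
      case 4
      show ?thesis
        using 4 x by (intro long_max_sum_nonneg[of "(n + 1) div 2"]) presburger+
    qed
  qed
qed

theorem theorem1:
  shows "(\<forall>a. positive_seq a \<and> coeff_conditions a \<longrightarrow>
             PS_on {0..pi} (\<lambda>k x. a k * sin (real k * x)))
       \<and> maximal_seq coeff_conditions max_seq
       \<and> (\<forall>a. 0 < a \<and> a < alpha \<longrightarrow>
             (\<exists>x\<in>{0..pi}. 2 * a * sin x + a * sin (2 * x) + gamma_seq 3 * sin (3 * x)
                + gamma_seq 4 * sin (4 * x) + gamma_seq 5 * sin (5 * x) < 0))"
  using PS_on_if_dominated[OF positive_max_seq _ max_seq_dominates PS_on_max_seq]
    maximal_max_seq quintic_sum_negative
  by blast

end
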